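(* Let $\bm p_0,\dots,\bm p_{m-1}$ be distinct points in $\mathbb{R}^d$ whose convex hull has dimension $d$, and let $\lambda\in(0,1)$. If $\lambda>m^{-1/d}$, then the iterated function system $\{f_j\}_{j=0}^{m-1}$, $f_j(\bm x)=\lambda\bm x+(1-\lambda)\bm p_j$, does not satisfy the Open Set Condition.
   Context: The iterated function system $\{f_j\}_{j=0}^{m-1}$ on $\mathbb{R}^d$ satisfies the Open Set Condition if there exists a nonempty open set $O\subset\mathbb{R}^d$ such that $\bigcup_{j=0}^{m-1}f_j(O)\subset O$, with the union being disjoint (i.e. $f_i(O)\cap f_j(O)=\emptyset$ for $i\ne j$). *)

theory Defs
  imports "HOL-Analysis.Analysis"
begin

text \<open>
  The system consists of \<open>f 0, \<dots>, f (m - 1)\<close>; values of \<open>f\<close> at indices \<open>\<ge> m\<close> are irrelevant.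
  Disjointness is indexed, so that \<open>f i = f j\<close> with \<open>i \<noteq> j\<close> violates the condition.
  The open set is not required to be bounded, and it may equal the union of its images.
\<close>

definition open_set_condition :: "nat \<Rightarrow> (nat \<Rightarrow> 'a \<Rightarrow> 'a::topological_space) \<Rightarrow> bool" where
  "open_set_condition m f \<longleftrightarrow>
     (\<exists>U. open U \<and> U \<noteq> {} \<and> (\<Union>j<m. f j ` U) \<subseteq> U \<and> disjoint_family_on (\<lambda>j. f j ` U) {..<m})"

end

theory Submission
  imports Defs
begin

text \<open>
  The images of an open set \<open>U\<close> witnessing the Open Set Condition are \<open>m\<close> disjoint copies of \<open>U\<close>
  inside \<open>U\<close>, each with volume scaled by \<open>l ^ d\<close>. If the volume of \<open>U\<close> is finite, comparing volumes
  gives \<open>m * l ^ d \<le> 1\<close>, against \<open>l > m powr (- 1 / d)\<close>. Since \<open>U\<close> may be unbounded, its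
  volume may be infinite, so \<open>U\<close> is first replaced by its intersection with a ball about the origin
  that contains all the \<open>p j\<close> and meets \<open>U\<close>: every map moves points towards some \<open>p j\<close>, so by
  convexity it sends the ball into itself, and the intersection witnesses the condition as well.
  The convex hull of the \<open>p j\<close> has dimension \<open>d \<ge> 0\<close>, so it is nonempty and \<open>m > 0\<close>; the empty
  system would satisfy the condition vacuously.
\<close>

text \<open>
  A witness may be cut down to any open convex set that meets it and contains every \<open>p j\<close>,
  since convexity makes such a set invariant; a large ball is a bounded choice.
\<close>

lemma open_set_condition_bounded_witness:
  fixes p :: "nat \<Rightarrow> 'a::real_normed_vector"
  assumes osc: "open_set_condition m (\<lambda>j x. l *\<^sub>R x + (1 - l) *\<^sub>R p j)"
    and l: "0 \<le> l" "l \<le> 1"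
  obtains V where "open V" "V \<noteq> {}" "bounded V"
    "(\<Union>j<m. (\<lambda>x. l *\<^sub>R x + (1 - l) *\<^sub>R p j) ` V) \<subseteq> V"
    "disjoint_family_on (\<lambda>j. (\<lambda>x. l *\<^sub>R x + (1 - l) *\<^sub>R p j) ` V) {..<m}"
proof -
  let ?f = "\<lambda>j x. l *\<^sub>R x + (1 - l) *\<^sub>R p j"
  obtain U where U: "open U" "U \<noteq> {}" "(\<Union>j<m. ?f j ` U) \<subseteq> U"
      "disjoint_family_on (\<lambda>j. ?f j ` U) {..<m}"
    using osc unfolding open_set_condition_def by blast
  obtain u where u: "u \<in> U"
    using U(2) by blast
  have "bounded (insert u (p ` {..<m}))"
    by (intro finite_imp_bounded) auto
  then obtain R where R: "insert u (p ` {..<m}) \<subseteq> ball 0 R"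
    using bounded_subset_ballD by metis
  let ?V = "U \<inter> ball 0 R"
  show thesis
  proof (rule that)
    show "open ?V" "bounded ?V"
      using U(1) by auto
    show "?V \<noteq> {}"
      using u R by blast
    have "?f j x \<in> ball 0 R" if "j < m" "x \<in> ball 0 R" for j x
      using l R that by (intro convexD[OF convex_ball]) auto
    then show "(\<Union>j<m. ?f j ` ?V) \<subseteq> ?V"
      using U(3) by fast
    show "disjoint_family_on (\<lambda>j. ?f j ` ?V) {..<m}"
      using U(4) by (rule disjoint_family_on_bisimulation) blast
  qed
qed

text \<open>
  For \<open>l < 1\<close> and \<open>m > 0\<close> this says that the similarity dimension of the system is at most the dimension of the
  space. A bounded witness has finite positive volume, which can be cancelled after comparing it with
  the volume of the disjoint union of the images.
\<close>

lemma open_set_condition_homothety_bound: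
  fixes p :: "nat \<Rightarrow> 'a::euclidean_space"
  assumes osc: "open_set_condition m (\<lambda>j x. l *\<^sub>R x + (1 - l) *\<^sub>R p j)"
    and l: "0 < l" "l \<le> 1"
  shows "real m * l ^ DIM('a) \<le> 1"
proof -
  let ?f = "\<lambda>j x. l *\<^sub>R x + (1 - l) *\<^sub>R p j"
  obtain V where V: "open V" "V \<noteq> {}" "bounded V" "(\<Union>j<m. ?f j ` V) \<subseteq> V"
      and disj: "disjoint_family_on (\<lambda>j. ?f j ` V) {..<m}"
    using open_set_condition_bounded_witness[OF osc] l by (metis less_imp_le)
  have Vm: "V \<in> lmeasurable"
    using V by (intro lmeasurable_open)
  have fm: "?f j ` V \<in> lmeasurable" if "j < m" for j
  proof (rule lmeasurable_open)
    show "bounded (?f j ` V)"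
      using V(3) by (rule bounded_subset) (use V(4) that in auto)
    show "open (?f j ` V)"
      using open_affinity[OF V(1), of l "(1 - l) *\<^sub>R p j"] l(1) by (simp add: add.commute)
  qed
  have pos: "0 < measure lebesgue V"
    using open_not_negligible[OF V(1,2)] Vm
    by (simp add: negligible_iff_measure0 zero_less_measure_iff)
  have "real m * l ^ DIM('a) * measure lebesgue V = (\<Sum>j<m. measure lebesgue (?f j ` V))"
    using l by (simp add: measure_lebesgue_affine)
  also have "\<dots> = measure lebesgue (\<Union>j<m. ?f j ` V)"
    using disj fm[THEN fmeasurableD] fm[THEN fmeasurableD2]
    by (intro measure_finite_Union[symmetric]) (simp_all add: image_subset_iff)
  also have "\<dots> \<le> measure lebesgue V"
    using V(4) Vm fm by (intro measure_mono_fmeasurable) auto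
  finally show ?thesis
    using pos by simp
qed

theorem proposition2p1:
  fixes p :: "nat \<Rightarrow> real ^ 'd" and m :: nat and l :: real
  assumes "inj_on p {..<m}"
    and "aff_dim (convex hull (p ` {..<m})) = int CARD('d)"
    and "0 < l" and "l < 1"
    and "l > real m powr (- 1 / real CARD('d))"
  shows "\<not> open_set_condition m (\<lambda>j x. l *\<^sub>R x + (1 - l) *\<^sub>R p j)"
proof
  assume osc: "open_set_condition m (\<lambda>j x. l *\<^sub>R x + (1 - l) *\<^sub>R p j)"
  have m: "m > 0"
    using assms(2) by (cases "m = 0") auto
  have "(real m powr (- 1 / real CARD('d))) ^ CARD('d) < l ^ CARD('d)"
    using assms(5) by (intro power_strict_mono) auto
  moreover have "(real m powr (- 1 / real CARD('d))) ^ CARD('d) = inverse (real m)"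
    using m powr_power[of "real m" "- 1 / real CARD('d)" "CARD('d)"] powr_minus[of "real m" 1] by simp
  ultimately have "inverse (real m) < l ^ CARD('d)"
    by (simp only:)
  then have "1 < real m * l ^ CARD('d)"
    using m by (simp add: field_simps)
  moreover have "real m * l ^ CARD('d) \<le> 1"
    using open_set_condition_homothety_bound[OF osc] assms(3,4) by simp
  ultimately show False
    by simp
qed

end
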